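(* Let $n\ge 1$ be an integer. The set of degree $n$ telescoping polynomials is exactly $$\left\{\frac{B_n(x)}{n!}+c \;:\; c\in\mathbb{R}\right\}.$$ That is, a real polynomial $p$ of degree $n$ with leading coefficient $1/n!$ satisfies $p^{(\ell)}(0)=p^{(\ell)}(1)$ for all integers $0\le \ell\le n-2$ if and only if $p(x)=B_n(x)/n!+c$ for some constant $c\in\mathbb{R}$.
   Context: The Bernoulli polynomials $B_n(x)$ are defined by $B_0(x)=1$ and, for $n\ge1$, $\frac{d}{dx}B_n(x)=nB_{n-1}(x)$ together with $\int_0^1 B_n(x)\,dx=0$. A real polynomial $p$ of degree $n$ with leading coefficient $1/n!$ is called a telescoping polynomial if $p^{(\ell)}(0)=p^{(\ell)}(1)$ for all integers $\ell$ with $0\le \ell\le n-2$ (a vacuous condition when $n=1$). *)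

theory Defs
  imports "HOL-Analysis.Analysis" "HOL-Computational_Algebra.Polynomial"
begin

text \<open>\<open>THE\<close> is well-defined by \<open>bernoulli_poly_step_ex1\<close> below, which yields the
  defining properties as \<open>pderiv_bernoulli_poly\<close> and \<open>integral_bernoulli_poly\<close>.\<close>

primrec bernoulli_poly :: "nat \<Rightarrow> real poly" where
  "bernoulli_poly 0 = 1"
| "bernoulli_poly (Suc n) =
     (THE q. pderiv q = smult (of_nat (Suc n)) (bernoulli_poly n) \<and>
             integral {0..1} (poly q) = 0)"

lemma pderiv_surj: "\<exists>q::real poly. pderiv q = p"
proof
  show "pderiv (\<Sum>i\<le>degree p. monom (coeff p i / real (Suc i)) (Suc i)) = p"
    by (simp add: higher_pderiv_sum[of 1, simplified] pderiv_monom poly_as_sum_of_monoms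
        del: of_nat_Suc)
qed

lemma poly_integrable_on: "poly (q::real poly) integrable_on {0..1}"
  by (intro integrable_continuous_real continuous_intros)

lemma integral_poly_add_const:
  "integral {0..1} (poly (q + [:c:])) = integral {0..1} (poly (q::real poly)) + c"
proof -
  have "integral {0..1} (\<lambda>x. poly q x + c) = integral {0..1} (poly q) + integral {0..1} (\<lambda>_::real. c)"
    by (rule integral_add[OF poly_integrable_on]) auto
  moreover have "poly (q + [:c:]) = (\<lambda>x. poly q x + c)" by auto
  ultimately show ?thesis by simp
qed

lemma bernoulli_poly_step_ex1:
  "\<exists>!q::real poly. pderiv q = p \<and> integral {0..1} (poly q) = 0"
proof -
  obtain q :: "real poly" where q: "pderiv q = p" using pderiv_surj by blast
  define q' where "q' = q + [:- integral {0..1} (poly q):]"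
  show ?thesis
  proof (rule ex1I[of _ q'], intro conjI)
    show "pderiv q' = p" by (simp add: q'_def q pderiv_add pderiv_pCons)
    show "integral {0..1} (poly q') = 0"
      unfolding q'_def by (subst integral_poly_add_const) simp
    fix r :: "real poly" assume r: "pderiv r = p \<and> integral {0..1} (poly r) = 0"
    have "pderiv (r - q') = 0" using r \<open>pderiv q' = p\<close> by (simp add: pderiv_diff)
    then obtain c where c: "r - q' = [:c:]" by (auto simp: pderiv_eq_0_iff elim: degree_eq_zeroE)
    hence "r = q' + [:c:]" by (simp add: algebra_simps)
    thus "r = q'" using r \<open>integral {0..1} (poly q') = 0\<close> integral_poly_add_const[of q' c] by simp
  qed
qed

lemma
  shows pderiv_bernoulli_poly:
      "pderiv (bernoulli_poly (Suc n)) = smult (of_nat (Suc n)) (bernoulli_poly n)"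
    and integral_bernoulli_poly: "integral {0..1} (poly (bernoulli_poly (Suc n))) = 0"
  using theI'[OF bernoulli_poly_step_ex1[of "smult (of_nat (Suc n)) (bernoulli_poly n)"]]
  by simp_all

text \<open>The range \<open>0 \<le> l \<le> n - 2\<close> is written \<open>l + 2 \<le> n\<close> because subtraction on \<open>nat\<close>
  truncates; for \<open>n = 1\<close> it is empty.\<close>

definition telescoping_poly :: "real poly \<Rightarrow> bool" where
  "telescoping_poly p \<longleftrightarrow>
     lead_coeff p = 1 / fact (degree p) \<and>
     (\<forall>l. l + 2 \<le> degree p \<longrightarrow>
        poly ((pderiv ^^ l) p) 0 = poly ((pderiv ^^ l) p) 1)"

end

theory Submission
  imports Defs
begin

text \<open>Differentiation sends a telescoping polynomial of degree \<open>n + 2\<close> to one of degree \<open>n + 1\<close>,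
  and the only condition lost is \<open>p(0) = p(1)\<close>, which says that \<open>p'\<close> has integral zero over \<open>[0,1]\<close>.
  Hence, by induction, \<open>p\<close> of degree \<open>n + 1\<close> is telescoping iff \<open>p' = B\<^sub>n / n!\<close>.\<close>

text \<open>Dividing by \<open>fact n\<close> absorbs the factor \<open>Suc n\<close> of the
  recurrence, so that differentiation just lowers the index.\<close>

definition scaled_bernoulli_poly :: "nat \<Rightarrow> real poly" where
  "scaled_bernoulli_poly n = smult (1 / fact n) (bernoulli_poly n)"

lemma pderiv_scaled_bernoulli_poly:
  "pderiv (scaled_bernoulli_poly (Suc n)) = scaled_bernoulli_poly n"
  by (simp add: scaled_bernoulli_poly_def pderiv_smult pderiv_bernoulli_poly del: bernoulli_poly.simps)

lemma integral_scaled_bernoulli_poly: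
  "integral {0..1} (poly (scaled_bernoulli_poly (Suc n))) = 0"
proof -
  have "poly (scaled_bernoulli_poly (Suc n)) = (\<lambda>x. 1 / fact (Suc n) * poly (bernoulli_poly (Suc n)) x)"
    by (simp add: scaled_bernoulli_poly_def fun_eq_iff del: bernoulli_poly.simps fact_Suc)
  then show ?thesis
    using integral_bernoulli_poly[of n] by (simp del: bernoulli_poly.simps fact_Suc)
qed

text \<open>Applied with q a derivative p', this splits the target equation of the induction step
  into an equation for p'' and the integral condition on p'.\<close>

lemma scaled_bernoulli_poly_Suc_unique:
  "q = scaled_bernoulli_poly (Suc n) \<longleftrightarrow>
     pderiv q = scaled_bernoulli_poly n \<and> integral {0..1} (poly q) = 0"
  using bernoulli_poly_step_ex1[of "scaled_bernoulli_poly n"]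
    pderiv_scaled_bernoulli_poly[of n] integral_scaled_bernoulli_poly[of n] by blast

lemma degree_scaled_bernoulli_poly:
  "scaled_bernoulli_poly n \<noteq> 0 \<and> degree (scaled_bernoulli_poly n) = n"
proof (induction n)
  case 0
  show ?case by (simp add: scaled_bernoulli_poly_def)
next
  case (Suc n)
  \<comment> \<open>Nonvanishing is carried through the induction to exclude degree 0 here: since
    subtraction truncates, \<open>degree - 1 = n\<close> alone would not do so when n = 0.\<close>
  then have "pderiv (scaled_bernoulli_poly (Suc n)) \<noteq> 0"
    by (simp add: pderiv_scaled_bernoulli_poly)
  then have "degree (scaled_bernoulli_poly (Suc n)) \<noteq> 0"
    by (simp add: pderiv_eq_0_iff)
  moreover have "degree (scaled_bernoulli_poly (Suc n)) - 1 = n"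
    using Suc degree_pderiv[of "scaled_bernoulli_poly (Suc n)"]
    by (simp add: pderiv_scaled_bernoulli_poly)
  ultimately show ?case by auto
qed

lemma integral_pderiv:
  fixes p :: "real poly"
  shows "integral {0..1} (poly (pderiv p)) = poly p 1 - poly p 0"
proof (rule integral_unique, rule fundamental_theorem_of_calculus)
  show "(poly p has_vector_derivative poly (pderiv p) x) (at x within {0..1})" for x
    by (metis DERIV_subset has_real_derivative_iff_has_vector_derivative poly_DERIV subset_UNIV)
qed simp

lemma lead_coeff_pderiv:
  fixes p :: "real poly"
  assumes "degree p = Suc n"
  shows "lead_coeff (pderiv p) = of_nat (Suc n) * lead_coeff p"
  using assms by (simp add: degree_pderiv coeff_pderiv)

text \<open>The degree must be at least 2: in degree 1 the equation p(0) = p(1) is not among the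
  telescoping conditions, and it fails for p = x.\<close>

lemma telescoping_poly_pderiv_iff:
  assumes "degree p = Suc (Suc n)"
  shows "telescoping_poly p \<longleftrightarrow> telescoping_poly (pderiv p) \<and> poly p 0 = poly p 1"
proof -
  have deg: "degree (pderiv p) = Suc n"
    using assms by (simp add: degree_pderiv)
  have "lead_coeff (pderiv p) = 1 / fact (Suc n) \<longleftrightarrow> lead_coeff p = 1 / fact (Suc (Suc n))"
    unfolding lead_coeff_pderiv[OF assms] fact_Suc[of "Suc n"]
    by (simp add: field_simps del: fact_Suc of_nat_Suc)
  moreover have
    "(\<forall>l. l + 2 \<le> Suc (Suc n) \<longrightarrow> poly ((pderiv ^^ l) p) 0 = poly ((pderiv ^^ l) p) 1) \<longleftrightarrow>
     (\<forall>l. l + 2 \<le> Suc n \<longrightarrow>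
        poly ((pderiv ^^ l) (pderiv p)) 0 = poly ((pderiv ^^ l) (pderiv p)) 1) \<and>
     poly p 0 = poly p 1"
    (is "(\<forall>l. ?P l) \<longleftrightarrow> (\<forall>l. ?Q l) \<and> ?R")
  proof -
    \<comment> \<open>The case l = 0 is p(0) = p(1); the case \<open>Suc l\<close> is the condition
      of index l on the derivative.\<close>
    have "(\<forall>l. ?P l) \<longleftrightarrow> ?P 0 \<and> (\<forall>l. ?P (Suc l))"
      by (metis not0_implies_Suc)
    then show ?thesis
      by (auto simp: funpow_Suc_right simp del: funpow.simps(2))
  qed
  ultimately show ?thesis
    unfolding telescoping_poly_def assms deg by blast
qed

lemma telescoping_poly_iff_pderiv_eq:
  assumes "degree p = Suc n"
  shows "telescoping_poly p \<longleftrightarrow> pderiv p = scaled_bernoulli_poly n"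
  using assms
proof (induction n arbitrary: p)
  case 0
  \<comment> \<open>In degree 1 no boundary condition remains, and leading coefficient 1 means that
    the constant p' is 1.\<close>
  then have "degree (pderiv p) = 0"
    by (simp add: degree_pderiv)
  then obtain c where c: "pderiv p = [:c:]"
    by (rule degree_eq_zeroE)
  with lead_coeff_pderiv[OF 0] have "lead_coeff p = c" by simp
  with 0 c show ?case
    by (auto simp: telescoping_poly_def scaled_bernoulli_poly_def one_pCons)
next
  case (Suc n)
  have "telescoping_poly (pderiv p) \<longleftrightarrow> pderiv (pderiv p) = scaled_bernoulli_poly n"
    using Suc by (simp add: degree_pderiv)
  \<comment> \<open>The integral of p' over [0,1] is p(1) - p(0), so the integral condition is
    exactly p(0) = p(1).\<close>
  then show ?case
    unfolding telescoping_poly_pderiv_iff[OF Suc.prems] scaled_bernoulli_poly_Suc_unique integral_pderiv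
    by auto
qed

lemma pderiv_eq_pderiv_iff:
  fixes p q :: "real poly"
  shows "pderiv p = pderiv q \<longleftrightarrow> (\<exists>c. p = q + [:c:])"
proof
  assume "pderiv p = pderiv q"
  then have "degree (p - q) = 0"
    by (simp add: pderiv_diff flip: pderiv_eq_0_iff)
  then obtain c where "p - q = [:c:]" by (rule degree_eq_zeroE)
  then show "\<exists>c. p = q + [:c:]" by (metis add.commute diff_add_cancel)
qed (auto simp: pderiv_add pderiv_pCons)

theorem theorem3p1:
  fixes n :: nat
  assumes "n \<ge> 1"
  shows "{p. degree p = n \<and> telescoping_poly p} =
         {smult (1 / fact n) (bernoulli_poly n) + [:c:] | c :: real. True}"
proof -
  obtain m where m: "n = Suc m"
    using assms by (cases n) auto
  \<comment> \<open>The criterion presupposes the degree, so the converse inclusion needs this; as n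
    is positive, adding a constant preserves the degree.\<close>
  have deg: "degree (scaled_bernoulli_poly n + [:c:]) = n" for c
    using degree_scaled_bernoulli_poly[of n] by (simp add: m degree_add_eq_left)
  have "degree p = n \<and> telescoping_poly p \<longleftrightarrow> (\<exists>c. p = scaled_bernoulli_poly n + [:c:])" for p
    using telescoping_poly_iff_pderiv_eq[of p m] pderiv_eq_pderiv_iff[of p "scaled_bernoulli_poly n"]
      deg pderiv_scaled_bernoulli_poly[of m] m by metis
  then show ?thesis
    unfolding scaled_bernoulli_poly_def by blast
qed

end
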